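(* Let $f,g_1,\dots,g_m:\mathbb{R}^n\to\mathbb{R}$ be continuously differentiable, consider the problem of minimizing $f(x)$ subject to $g_i(x)\le 0$ for all $i\in[m]$, and let $\mathcal{F}=\{x\in\mathbb{R}^n: g_i(x)\le 0\ \forall i\in[m]\}$. Assume that: (i) $f$ is $L_f$-smooth and each $g_i$ is $L_i$-smooth; (ii) the problem is feasible and bounded below, and its optimal value $f^\star$ is attained at some $x^\star\in\mathcal{F}$; (iii) MFCQ holds at every $x\in\mathcal{F}$. Fix $\alpha>0$ and $w_1,\dots,w_m>0$, and let $u(x)$ be the solution of the QCQP given in the context. Let $x(t)$, $t\ge 0$, be any solution of the ODE $\dot x(t)=u(x(t))$ with feasible initial condition $x(0)\in\mathcal{F}$. Then: 1. (Anytime feasibility) $g_i(x(t))\le 0$ for all $t>0$ and all $i\in[m]$. 2. (Convergence) $\frac12\int_0^t\|u(x(\tau))\|_2^2\,d\tau\le f(x(0))-f^\star$ for all $t>0$.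
   Context: $[m]=\{1,\dots,m\}$. A continuously differentiable function is $L$-smooth if its gradient is $L$-Lipschitz in the Euclidean norm. The Mangasarian-Fromovitz constraint qualification (MFCQ) holds at $x$ if there exists $d\in\mathbb{R}^n$ with $\nabla g_i(x)^\top d<0$ for all $i\in\mathcal{I}(x)$, where $\mathcal{I}(x)=\{i\in[m]:g_i(x)=0\}$. The direction field $u(x)$ is the unique minimizer of the convex QCQP $$u(x):=\arg\min_{u\in\mathbb{R}^n}\ \tfrac12\|u+\nabla f(x)\|_2^2\quad\text{s.t.}\quad \nabla g_i(x)^\top u\le-\alpha g_i(x)-w_i\|u\|_2^2\quad\forall i\in[m],$$ which is defined at every $x$ for which the QCQP is feasible. A solution of the ODE is a differentiable curve $x:[0,\infty)\to\mathbb{R}^n$ such that $u(x(t))$ is defined and $\dot x(t)=u(x(t))$ for all $t\ge0$; uniqueness of solutions is not assumed. *)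

theory Defs
  imports "HOL-Analysis.Analysis"
begin

definition grad :: "(real ^ 'n \<Rightarrow> real) \<Rightarrow> real ^ 'n \<Rightarrow> real ^ 'n" where
  "grad h x = (THE D. GDERIV h x :> D)"

definition cont_diff :: "(real ^ 'n \<Rightarrow> real) \<Rightarrow> bool" where
  "cont_diff h \<longleftrightarrow> (\<forall>x. h differentiable (at x)) \<and> continuous_on UNIV (grad h)"

definition L_smooth :: "real \<Rightarrow> (real ^ 'n \<Rightarrow> real) \<Rightarrow> bool" where
  "L_smooth L h \<longleftrightarrow> cont_diff h \<and> L-lipschitz_on UNIV (grad h)"

definition feasible_set :: "nat \<Rightarrow> (nat \<Rightarrow> real ^ 'n \<Rightarrow> real) \<Rightarrow> (real ^ 'n) set" where
  "feasible_set m g = {x. \<forall>i\<in>{1..m}. g i x \<le> 0}"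

definition optimal_value ::
  "nat \<Rightarrow> (real ^ 'n \<Rightarrow> real) \<Rightarrow> (nat \<Rightarrow> real ^ 'n \<Rightarrow> real) \<Rightarrow> real" where
  "optimal_value m f g = (INF x\<in>feasible_set m g. f x)"

definition active_set :: "nat \<Rightarrow> (nat \<Rightarrow> real ^ 'n \<Rightarrow> real) \<Rightarrow> real ^ 'n \<Rightarrow> nat set" where
  "active_set m g x = {i\<in>{1..m}. g i x = 0}"

definition MFCQ :: "nat \<Rightarrow> (nat \<Rightarrow> real ^ 'n \<Rightarrow> real) \<Rightarrow> real ^ 'n \<Rightarrow> bool" where
  "MFCQ m g x \<longleftrightarrow> (\<exists>d. \<forall>i\<in>active_set m g x. grad (g i) x \<bullet> d < 0)"

definition qcqp_constraints ::
  "nat \<Rightarrow> (nat \<Rightarrow> real ^ 'n \<Rightarrow> real) \<Rightarrow> real \<Rightarrow> (nat \<Rightarrow> real) \<Rightarrow> real ^ 'n \<Rightarrow> (real ^ 'n) set" where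
  "qcqp_constraints m g \<alpha> w x =
     {u. \<forall>i\<in>{1..m}. grad (g i) x \<bullet> u \<le> - \<alpha> * g i x - w i * (norm u)\<^sup>2}"

text \<open>The minimizer below exists and is unique exactly where the constraint set is nonempty
  (lemma \<open>qcqp_unique_minimizer\<close>, for nonnegative weights); elsewhere the value is unspecified.\<close>

definition direction_field ::
  "nat \<Rightarrow> (real ^ 'n \<Rightarrow> real) \<Rightarrow> (nat \<Rightarrow> real ^ 'n \<Rightarrow> real) \<Rightarrow> real \<Rightarrow> (nat \<Rightarrow> real)
     \<Rightarrow> real ^ 'n \<Rightarrow> real ^ 'n" where
  "direction_field m f g \<alpha> w x =
     (THE u. is_arg_min (\<lambda>v. 1 / 2 * (norm (v + grad f x))\<^sup>2)
               (\<lambda>v. v \<in> qcqp_constraints m g \<alpha> w x) u)"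

text \<open>The derivative at \<open>t = 0\<close> is one-sided, the curve being defined on \<open>{0..}\<close> only.\<close>

definition ode_solution ::
  "nat \<Rightarrow> (real ^ 'n \<Rightarrow> real) \<Rightarrow> (nat \<Rightarrow> real ^ 'n \<Rightarrow> real) \<Rightarrow> real \<Rightarrow> (nat \<Rightarrow> real)
     \<Rightarrow> (real \<Rightarrow> real ^ 'n) \<Rightarrow> bool" where
  "ode_solution m f g \<alpha> w x \<longleftrightarrow>
     (\<forall>t\<ge>0. qcqp_constraints m g \<alpha> w (x t) \<noteq> {} \<and>
        (x has_vector_derivative direction_field m f g \<alpha> w (x t)) (at t within {0..}))"

lemma grad_eq:
  assumes "GDERIV h x :> D"
  shows "grad h x = D"
  unfolding grad_def
proof (rule the_equality)
  show "D' = D" if "GDERIV h x :> D'" for D'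
  proof -
    have "(\<lambda>v. v \<bullet> D') = (\<lambda>v. v \<bullet> D)"
      using that assms unfolding gderiv_def by (rule has_derivative_unique)
    then show ?thesis
      by (metis vector_eq_ldot)
  qed
qed (fact assms)

lemma GDERIV_grad:
  assumes "h differentiable (at x)"
  shows "GDERIV h x :> grad h x"
proof -
  obtain h' where h': "(h has_derivative h') (at x)"
    using assms unfolding differentiable_def by blast
  then interpret linear h'
    by (rule has_derivative_linear)
  have "h' = (\<lambda>v. v \<bullet> adjoint h' 1)"
    using adjoint_works[OF linear_axioms, where y = "1 :: real"] by auto
  then have "GDERIV h x :> adjoint h' 1"
    using h' unfolding gderiv_def by simp
  then show ?thesis
    using grad_eq by metis
qed

lemma qcqp_unique_minimizer:
  fixes f :: "real ^ 'n \<Rightarrow> real"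
  assumes w: "\<And>i. i \<in> {1..m} \<Longrightarrow> w i \<ge> 0"
    and ne: "qcqp_constraints m g \<alpha> w x \<noteq> {}"
  shows "\<exists>!u. is_arg_min (\<lambda>v. 1 / 2 * (norm (v + grad f x))\<^sup>2)
                (\<lambda>v. v \<in> qcqp_constraints m g \<alpha> w x) u"
proof -
  let ?C = "qcqp_constraints m g \<alpha> w x" and ?z = "- grad f x"
  define q where "q i u = grad (g i) x \<bullet> u + w i * (norm u)\<^sup>2" for i u
  have C: "?C = (\<Inter>i\<in>{1..m}. {u. q i u \<le> - \<alpha> * g i x})"
    unfolding qcqp_constraints_def q_def by (simp add: set_eq_iff le_diff_eq)
  have sq: "convex_on UNIV (\<lambda>u :: real ^ 'n. (norm u)\<^sup>2)"
  proof (rule convex_onI)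
    fix t :: real and a b :: "real ^ 'n"
    assume t: "0 < t" "t < 1"
    have "(1 - t) * (norm a)\<^sup>2 + t * (norm b)\<^sup>2 - (norm ((1 - t) *\<^sub>R a + t *\<^sub>R b))\<^sup>2
        = t * (1 - t) * (norm (a - b))\<^sup>2"
      unfolding power2_norm_eq_inner by (simp add: algebra_simps inner_commute)
    moreover have "t * (1 - t) * (norm (a - b))\<^sup>2 \<ge> 0"
      using t by simp
    ultimately show "(norm ((1 - t) *\<^sub>R a + t *\<^sub>R b))\<^sup>2 \<le> (1 - t) * (norm a)\<^sup>2 + t * (norm b)\<^sup>2"
      by linarith
  qed simp
  have convex_q: "convex_on UNIV (q i)" if "i \<in> {1..m}" for i
    unfolding q_def
  proof (rule convex_on_add)
    show "convex_on UNIV (\<lambda>u. grad (g i) x \<bullet> u)"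
      by (rule convex_onI) (simp_all add: inner_add_right)
    show "convex_on UNIV (\<lambda>u :: real ^ 'n. w i * (norm u)\<^sup>2)"
      by (rule convex_on_cmul[OF w[OF that] sq])
  qed
  have "convex {u. q i u \<le> c}" if "i \<in> {1..m}" for i c
  proof (rule convexI)
    fix a b :: "real ^ 'n" and s t :: real
    assume a: "a \<in> {u. q i u \<le> c}" and b: "b \<in> {u. q i u \<le> c}"
      and st: "0 \<le> s" "0 \<le> t" "s + t = 1"
    have "q i (s *\<^sub>R a + t *\<^sub>R b) \<le> s * q i a + t * q i b"
      using convex_q[OF that] st unfolding convex_on_def by blast
    also have "\<dots> \<le> c"
      using a b st by (intro convex_bound_le) auto
    finally show "s *\<^sub>R a + t *\<^sub>R b \<in> {u. q i u \<le> c}"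
      by simp
  qed
  then have "convex ?C"
    unfolding C by (intro convex_INT)
  moreover have "closed ?C"
    unfolding C q_def by (intro closed_INT ballI closed_Collect_le continuous_intros)
  moreover have "is_arg_min (\<lambda>v. 1 / 2 * (norm (v + grad f x))\<^sup>2) (\<lambda>v. v \<in> ?C) u
      \<longleftrightarrow> u \<in> ?C \<and> (\<forall>v\<in>?C. dist ?z u \<le> dist ?z v)" for u
  proof -
    have "dist ?z v = norm (v + grad f x)" for v
      by (metis dist_commute dist_norm diff_minus_eq_add)
    moreover have "(norm a)\<^sup>2 < (norm b)\<^sup>2 \<longleftrightarrow> norm a < norm b" for a b :: "real ^ 'n"
      by (metis norm_ge_zero power_strict_mono power2_less_imp_less pos2)
    ultimately show ?thesis
      unfolding is_arg_min_def by (auto simp: not_less)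
  qed
  ultimately show ?thesis
    using ne closest_point_exists[of ?C ?z] closest_point_unique[of ?C _ ?z]
    by (metis (no_types, lifting))
qed

end

theory Submission
  imports Defs
begin

text \<open>Along a solution the QCQP constraint gives \<open>(g\<^sub>i \<circ> x)' \<le> - \<alpha> (g\<^sub>i \<circ> x)\<close>, so \<open>exp (\<alpha> t) g\<^sub>i (x t)\<close> is
  nonincreasing and feasibility is preserved. At a feasible point \<open>0\<close> satisfies the QCQP constraints;
  comparing its objective value with that of \<open>u\<close> gives \<open>\<parallel>u\<parallel>\<^sup>2 / 2 \<le> - \<nabla>f \<bullet> u = - (f \<circ> x)'\<close>, which is
  integrated over \<open>[0, t]\<close>.\<close>

text \<open>Chain rule with \<open>h\<close> differentiable in the full space but \<open>x\<close>
  only within \<open>S\<close>; taking \<open>{0..}\<close> for \<open>S\<close> covers the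
  one-sided derivative at time 0.\<close>

lemma has_real_derivative_along_curve:
  fixes h :: "real ^ 'n \<Rightarrow> real"
  assumes h: "h differentiable (at (x t))"
    and x: "(x has_vector_derivative v) (at t within S)"
  shows "((\<lambda>s. h (x s)) has_real_derivative grad h (x t) \<bullet> v) (at t within S)"
proof -
  have "(h has_derivative (\<lambda>y. y \<bullet> grad h (x t))) (at (x t))"
    using GDERIV_grad[OF h] unfolding gderiv_def .
  from has_derivative_compose[OF x[unfolded has_vector_derivative_def] this]
  show ?thesis
    unfolding has_real_derivative_iff_has_vector_derivative has_vector_derivative_def
    by (simp add: inner_commute)
qed

text \<open>The fundamental theorem for the gauge integral makes \<open>h'\<close> integrable
  without any continuity, so the increment of \<open>h\<close> is the integral of a nonpositive
  function.\<close>

lemma nonpos_derivative_imp_le: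
  fixes h :: "real \<Rightarrow> real"
  assumes t: "0 \<le> t"
    and deriv: "\<And>s. 0 \<le> s \<Longrightarrow> (h has_real_derivative h' s) (at s within {0..})"
    and nonpos: "\<And>s. 0 \<le> s \<Longrightarrow> h' s \<le> 0"
  shows "h t \<le> h 0"
proof -
  have "(h has_vector_derivative h' s) (at s within {0..t})" if "s \<in> {0..t}" for s
    using deriv[of s] that has_real_derivative_iff_has_vector_derivative
    by (metis atLeastAtMost_iff atLeastatMost_subset_iff atLeast_iff has_vector_derivative_within_subset subsetI)
  then have "(h' has_integral (h t - h 0)) {0..t}"
    by (rule fundamental_theorem_of_calculus[OF t])
  then have "h t - h 0 \<le> 0"
    by (rule has_integral_le[OF _ has_integral_0]) (simp add: nonpos)
  then show ?thesis by simp
qed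

lemma direction_field_is_arg_min:
  fixes f :: "real ^ 'n \<Rightarrow> real"
  assumes "\<And>i. i \<in> {1..m} \<Longrightarrow> w i \<ge> 0"
    and "qcqp_constraints m g \<alpha> w y \<noteq> {}"
  shows "is_arg_min (\<lambda>v. 1 / 2 * (norm (v + grad f y))\<^sup>2)
           (\<lambda>v. v \<in> qcqp_constraints m g \<alpha> w y) (direction_field m f g \<alpha> w y)"
  unfolding direction_field_def by (rule theI'[OF qcqp_unique_minimizer[OF assms]])

lemma direction_field_constraint:
  fixes f :: "real ^ 'n \<Rightarrow> real"
  assumes w: "\<And>i. i \<in> {1..m} \<Longrightarrow> w i \<ge> 0"
    and ne: "qcqp_constraints m g \<alpha> w y \<noteq> {}" and i: "i \<in> {1..m}"
  shows "grad (g i) y \<bullet> direction_field m f g \<alpha> w y \<le> - \<alpha> * g i y"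
proof -
  have "direction_field m f g \<alpha> w y \<in> qcqp_constraints m g \<alpha> w y"
    using direction_field_is_arg_min[OF w ne] unfolding is_arg_min_def by blast
  then have "grad (g i) y \<bullet> direction_field m f g \<alpha> w y
      \<le> - \<alpha> * g i y - w i * (norm (direction_field m f g \<alpha> w y))\<^sup>2"
    using i unfolding qcqp_constraints_def by blast
  moreover have "w i * (norm (direction_field m f g \<alpha> w y))\<^sup>2 \<ge> 0"
    using w[OF i] by simp
  ultimately show ?thesis by linarith
qed

lemma direction_field_descent:
  fixes f :: "real ^ 'n \<Rightarrow> real"
  assumes w: "\<And>i. i \<in> {1..m} \<Longrightarrow> w i \<ge> 0" and \<alpha>: "\<alpha> \<ge> 0"
    and y: "y \<in> feasible_set m g"
  shows "(norm (direction_field m f g \<alpha> w y))\<^sup>2 \<le> - 2 * (grad f y \<bullet> direction_field m f g \<alpha> w y)"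
proof -
  let ?u = "direction_field m f g \<alpha> w y"
  have zero: "0 \<in> qcqp_constraints m g \<alpha> w y"
    using \<alpha> y unfolding qcqp_constraints_def feasible_set_def
    by (simp add: mult_nonneg_nonpos)
  then have "qcqp_constraints m g \<alpha> w y \<noteq> {}"
    by blast
  from direction_field_is_arg_min[OF w this] zero
  have "(norm (?u + grad f y))\<^sup>2 \<le> (norm (0 + grad f y))\<^sup>2"
    unfolding is_arg_min_def by (fastforce simp: not_less)
  \<comment> \<open>Expanding both squares cancels the squared norm of
    \<open>grad f y\<close>.\<close>
  then show ?thesis
    unfolding power2_norm_eq_inner by (simp add: inner_add inner_commute)
qed

theorem theorem2:
  fixes f :: "real ^ 'n \<Rightarrow> real"
    and g :: "nat \<Rightarrow> real ^ 'n \<Rightarrow> real"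
    and m :: nat
    and Lf \<alpha> :: real
    and L w :: "nat \<Rightarrow> real"
    and xstar :: "real ^ 'n"
    and x :: "real \<Rightarrow> real ^ 'n"
  assumes f_C1: "cont_diff f"
    and g_C1: "\<And>i. i \<in> {1..m} \<Longrightarrow> cont_diff (g i)"
    and f_smooth: "L_smooth Lf f"
    and g_smooth: "\<And>i. i \<in> {1..m} \<Longrightarrow> L_smooth (L i) (g i)"
    and feasible: "feasible_set m g \<noteq> {}"
    and bounded_below: "bdd_below (f ` feasible_set m g)"
    and xstar_feasible: "xstar \<in> feasible_set m g"
    and xstar_optimal: "f xstar = optimal_value m f g"
    and mfcq: "\<And>y. y \<in> feasible_set m g \<Longrightarrow> MFCQ m g y"
    and alpha_pos: "\<alpha> > 0"
    and w_pos: "\<And>i. i \<in> {1..m} \<Longrightarrow> w i > 0"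
    and sol: "ode_solution m f g \<alpha> w x"
    and init: "x 0 \<in> feasible_set m g"
  shows "(\<forall>t>0. \<forall>i\<in>{1..m}. g i (x t) \<le> 0) \<and>
         (\<forall>t>0. (\<lambda>\<tau>. (norm (direction_field m f g \<alpha> w (x \<tau>)))\<^sup>2) integrable_on {0..t} \<and>
            1 / 2 * integral {0..t} (\<lambda>\<tau>. (norm (direction_field m f g \<alpha> w (x \<tau>)))\<^sup>2)
              \<le> f (x 0) - optimal_value m f g)"
proof -
  let ?u = "\<lambda>t. direction_field m f g \<alpha> w (x t)"
  have w: "\<And>i. i \<in> {1..m} \<Longrightarrow> w i \<ge> 0"
    using w_pos by (simp add: less_imp_le)
  have ne: "qcqp_constraints m g \<alpha> w (x t) \<noteq> {}"
    and x': "(x has_vector_derivative ?u t) (at t within {0..})" if "t \<ge> 0" for t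
    using sol that unfolding ode_solution_def by blast+
  have feas: "g i (x t) \<le> 0" if t: "t \<ge> 0" and i: "i \<in> {1..m}" for t i
  proof -
    have "((\<lambda>s. exp (\<alpha> * s) * g i (x s)) has_real_derivative
        exp (\<alpha> * s) * (\<alpha> * g i (x s) + grad (g i) (x s) \<bullet> ?u s)) (at s within {0..})"
      if "s \<ge> 0" for s
    proof -
      have "g i differentiable (at (x s))"
        using g_C1[OF i] unfolding cont_diff_def by blast
      note [derivative_intros] = has_real_derivative_along_curve[OF this x'[OF that]]
      show ?thesis
        by (auto intro!: derivative_eq_intros simp: algebra_simps)
    qed
    \<comment> \<open>The QCQP constraint bounds the bracket whatever the sign of
      \<open>g i (x s)\<close>, so feasibility at \<open>s\<close> is not presupposed and the
      argument is not circular.\<close>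
    moreover have "exp (\<alpha> * s) * (\<alpha> * g i (x s) + grad (g i) (x s) \<bullet> ?u s) \<le> 0" if "s \<ge> 0" for s
      using direction_field_constraint[OF w ne[OF that] i, of f]
      by (intro mult_nonneg_nonpos) auto
    ultimately have "exp (\<alpha> * t) * g i (x t) \<le> exp (\<alpha> * 0) * g i (x 0)"
      by (rule nonpos_derivative_imp_le[OF t])
    also have "\<dots> \<le> 0"
      using init i unfolding feasible_set_def by simp
    finally show ?thesis
      by (simp add: mult_le_0_iff)
  qed
  then have feas_set: "x t \<in> feasible_set m g" if "t \<ge> 0" for t
    using that unfolding feasible_set_def by blast
  have energy: "(\<lambda>\<tau>. (norm (?u \<tau>))\<^sup>2) integrable_on {0..t} \<and>
      1 / 2 * integral {0..t} (\<lambda>\<tau>. (norm (?u \<tau>))\<^sup>2) \<le> f (x 0) - optimal_value m f g"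
    if t: "t > 0" for t
  proof -
    \<comment> \<open>\<open>?h\<close> is the derivative of \<open>- 2 * f (x s)\<close> and
      dominates the squared speed pointwise; it yields both the integrability of that square and the
      bound on its integral.\<close>
    let ?h = "\<lambda>s. - 2 * (grad f (x s) \<bullet> ?u s)"
    have sub: "{0..t} \<subseteq> {0..}"
      by auto
    have bound: "(norm (?u s))\<^sup>2 \<le> ?h s" if "s \<in> {0..t}" for s
      using direction_field_descent[OF w less_imp_le[OF alpha_pos] feas_set] that by simp
    have "(?u has_integral (x t - x 0)) {0..t}"
      using t sub by (intro fundamental_theorem_of_calculus)
        (auto intro: has_vector_derivative_within_subset[OF x'])
    \<comment> \<open>\<open>?u\<close> need not be continuous in \<open>t\<close>; it is measurable because it is a derivative.\<close>
    then have meas: "?u \<in> borel_measurable (lebesgue_on {0..t})"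
      by (intro integrable_imp_measurable) (rule has_integral_integrable)
    have "((\<lambda>s. - 2 * f (x s)) has_vector_derivative ?h s) (at s within {0..t})"
      if "s \<in> {0..t}" for s
    proof -
      have "((\<lambda>s. f (x s)) has_real_derivative grad f (x s) \<bullet> ?u s) (at s within {0..})"
        using f_C1 that unfolding cont_diff_def
        by (intro has_real_derivative_along_curve x') auto
      from DERIV_cmult[OF DERIV_subset[OF this sub], of "- 2"] show ?thesis
        by (simp add: has_real_derivative_iff_has_vector_derivative)
    qed
    then have h: "(?h has_integral (- 2 * f (x t) - - 2 * f (x 0))) {0..t}"
      using t by (intro fundamental_theorem_of_calculus) auto
    have "(\<lambda>s. (norm (?u s))\<^sup>2) \<in> borel_measurable (lebesgue_on {0..t})"
      using meas by measurable
    \<comment> \<open>A measurable nonnegative function lying below an integrable one is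
      integrable.\<close>
    then have int: "(\<lambda>s. (norm (?u s))\<^sup>2) integrable_on {0..t}"
      using bound by (intro measurable_bounded_by_integrable_imp_integrable[OF _ has_integral_integrable[OF h]]) auto
    then have "integral {0..t} (\<lambda>s. (norm (?u s))\<^sup>2) \<le> - 2 * f (x t) - - 2 * f (x 0)"
      by (rule has_integral_le[OF integrable_integral h]) (rule bound)
    \<comment> \<open>Feasibility of \<open>x t\<close> places \<open>f (x t)\<close> among the
      values of the infimum, which is a true lower bound because \<open>f\<close> is bounded below
      there.\<close>
    moreover have "optimal_value m f g \<le> f (x t)"
      unfolding optimal_value_def using t by (intro cINF_lower bounded_below feas_set) simp
    ultimately show ?thesis
      using int by linarith
  qed
  show ?thesis
    using feas energy by simp
qed

end
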